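(* Suppose $G$ is a finite group, $X$ is a metrizable compact $G$-space, and $\mu$ is a probability $G$-invariant Borel measure on $X$. For every finite $r$ we have (1) $ms(X,r)\ge ms(G\times I,r)$; (2) $ms(X,r)=ms(G\times I,r)$ if the measure $\mu$ is continuous and $|G\cdot x|=|G|$ for almost all $x\in X$.
   Context: Setting: a finite group $G$ acts on a compact space $X$ endowed with a probability Borel measure $\mu$ invariant under this action. For every finite $r$, $ms(X,r)$ is defined as the least upper bound of $\varepsilon>0$ such that for every measurable $r$-coloring of $X$ (a coloring whose color classes are $\mu$-measurable) there exists a monochromatic subset $A\subset X$ of measure $\mu(A)\ge\varepsilon$ such that $A=g\cdot A$ for some non-identity element $g\in G$. Here $I$ denotes the interval $[0,1]$ endowed with the standard Lebesgue measure $\lambda$. For a compact group $G$, the cylinder $G\times I$ is considered as a left $G$-space with action $g\cdot(h,t)=(gh,t)$ for $g\in G$, $(h,t)\in G\times I$, endowed with the product measure (Haar measure on $G$) $\times\lambda$; $ms(G\times I,r)$ is defined for this $G$-space in the same way. A measure $\mu$ on $X$ is called continuous if $\mu(\{x\})=0$ for every $x\in X$. $G\cdot x$ denotes the orbit of $x$. *)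

theory Defs
  imports "HOL-Probability.Probability" "HOL-Algebra.Group_Action"
begin

definition borel_of :: "'x topology \<Rightarrow> 'x measure" where
  "borel_of X = sigma (topspace X) {U. openin X U}"

text \<open>Joint continuity, when the finite group carries the discrete topology, amounts to continuity of each translation.\<close>

definition continuous_group_action ::
    "('g, 'm) monoid_scheme \<Rightarrow> 'x topology \<Rightarrow> ('g \<Rightarrow> 'x \<Rightarrow> 'x) \<Rightarrow> bool" where
  "continuous_group_action G X \<phi> \<longleftrightarrow>
     group_action G (topspace X) \<phi> \<and> (\<forall>g\<in>carrier G. continuous_map X X (\<phi> g))"

definition invariant_measure ::
    "('g, 'm) monoid_scheme \<Rightarrow> ('g \<Rightarrow> 'x \<Rightarrow> 'x) \<Rightarrow> 'x measure \<Rightarrow> bool" where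
  "invariant_measure G \<phi> M \<longleftrightarrow>
     (\<forall>g\<in>carrier G. \<forall>A\<in>sets M. emeasure M (\<phi> g ` A) = emeasure M A)"

definition continuous_measure :: "'x measure \<Rightarrow> bool" where
  "continuous_measure M \<longleftrightarrow> (\<forall>x\<in>space M. emeasure M {x} = 0)"

text \<open>
  Colour classes and monochromatic sets are measurable with respect to the completed measure.
  The supremum is taken in the extended nonnegative reals, so it is \<open>0\<close> when no
  \<open>\<epsilon> > 0\<close> qualifies (for instance when \<open>G\<close> is trivial and \<open>r > 0\<close>).
\<close>

definition ms ::
    "('g, 'm) monoid_scheme \<Rightarrow> ('g \<Rightarrow> 'x \<Rightarrow> 'x) \<Rightarrow> 'x measure \<Rightarrow> nat \<Rightarrow> ennreal" where
  "ms G \<phi> M r = Sup {\<epsilon>. 0 < \<epsilon> \<and>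
     (\<forall>f \<in> measurable (completion M) (count_space {..<r}).
        \<exists>A \<in> sets (completion M).
          (\<exists>c. \<forall>x\<in>A. f x = c) \<and>
          \<epsilon> \<le> emeasure (completion M) A \<and>
          (\<exists>g\<in>carrier G. g \<noteq> \<one>\<^bsub>G\<^esub> \<and> A = \<phi> g ` A))}"

text \<open>
  Normalized Haar measure of a finite group times Lebesgue measure on \<open>[0,1]\<close>, as a Borel
  measure on the cylinder; passing to Lebesgue measurable sets is done by the completion
  in the definition of \<open>ms\<close>.
\<close>

definition cylinder_measure :: "('g, 'm) monoid_scheme \<Rightarrow> ('g \<times> real) measure" where
  "cylinder_measure G =
     uniform_count_measure (carrier G) \<Otimes>\<^sub>M restrict_space lborel {0..1}"

definition cylinder_action :: "('g, 'm) monoid_scheme \<Rightarrow> 'g \<Rightarrow> 'g \<times> real \<Rightarrow> 'g \<times> real" where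
  "cylinder_action G g =
     restrict (\<lambda>(h, t). (g \<otimes>\<^bsub>G\<^esub> h, t)) (carrier G \<times> {0..1})"

end

theory Submission imports Defs "HOL-Algebra.Generated_Groups" begin

text \<open>
  The largest \<open>g\<close>-invariant subset of a colour class of \<open>f\<close> consists of the points whose whole
  \<open>\<langle>g\<rangle>\<close>-orbit has that colour, so its measure is determined by the law of the random pattern
  \<open>h \<mapsto> f (h x)\<close>. Hence \<open>ms\<close> is an infimum over the pattern laws of all colourings, and it suffices
  to compare the sets of laws that occur. If \<open>q\<close> is a random pattern on \<open>[0,1]\<close> with the law of a
  colouring of \<open>X\<close>, then this law, being invariant under translations, is also the pattern law of the
  colouring \<open>(h, t) \<mapsto> q t h\<close> of \<open>G \<times> I\<close>, which gives (1).

  For (2), pull colourings back along a measure preserving equivariant map \<open>X \<rightarrow> G \<times> I\<close>.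
  Fix an injective Borel map \<open>\<tau> : X \<rightarrow> \<real>\<close>. On a free orbit the place where \<open>\<tau>\<close> is minimal
  is an equivariant \<open>G\<close>-coordinate, and the minimum itself is an invariant function. The law of
  the minimum has no atoms, so its distribution function makes it uniform. Moving the
  point by an independent uniformly random element of \<open>G\<close> does not change its law, but makes the
  coordinate uniform and independent of the minimum.
\<close>

section \<open>Borel maps into the reals\<close>

definition ternary :: "nat set \<Rightarrow> real" where
  "ternary S = (\<Sum>i. indicator S i / 3 ^ i)"

lemma sums_inverse_powers_of_3: "(\<lambda>i. 1 / 3 ^ i :: real) sums (3 / 2)"
  using geometric_sums[of "1 / 3 :: real"] by (simp add: power_divide)

lemma summable_ternary: "summable (\<lambda>i. indicator S i / 3 ^ i :: real)"
  using sums_summable[OF sums_inverse_powers_of_3]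
  by (rule summable_comparison_test') (simp add: indicator_def)

lemma ternary_nonneg: "0 \<le> ternary S"
  unfolding ternary_def using summable_ternary by (intro suminf_nonneg) auto

lemma ternary_le: "ternary S \<le> 3 / 2"
  unfolding ternary_def sums_unique[OF sums_inverse_powers_of_3]
  using summable_ternary sums_summable[OF sums_inverse_powers_of_3]
  by (intro suminf_le) (auto simp: indicator_def)

lemma ternary_split_head: "ternary S = indicator S 0 + ternary (Suc -` S) / 3"
proof -
  have "(\<lambda>i. indicator S (Suc i) / 3 ^ Suc i :: real) = (\<lambda>i. (indicator (Suc -` S) i / 3 ^ i) / 3)"
    by (simp add: indicator_def fun_eq_iff)
  then have "(\<Sum>i. indicator S (Suc i) / 3 ^ Suc i :: real) = ternary (Suc -` S) / 3"
    using suminf_divide[OF summable_ternary] by (simp add: ternary_def)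
  then show ?thesis
    using suminf_split_head[OF summable_ternary, of S] by (simp add: ternary_def)
qed

lemma ternary_eq_imp_head_eq:
  assumes "ternary S = ternary T"
  shows "0 \<in> S \<longleftrightarrow> 0 \<in> T"
  using assms ternary_split_head[of S] ternary_split_head[of T]
    ternary_nonneg[of "Suc -` S"] ternary_nonneg[of "Suc -` T"]
    ternary_le[of "Suc -` S"] ternary_le[of "Suc -` T"]
  by (cases "0 \<in> S"; cases "0 \<in> T") auto

lemma inj_ternary: "inj ternary"
proof (rule injI)
  have "n \<in> S \<longleftrightarrow> n \<in> T" if "ternary S = ternary T" for n S T
    using that
  proof (induction n arbitrary: S T)
    case 0
    then show ?case by (rule ternary_eq_imp_head_eq)
  next
    case (Suc n)
    have "indicator S 0 = (indicator T 0 :: real)"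
      using ternary_eq_imp_head_eq[OF Suc.prems] by (simp add: indicator_def)
    then have "ternary (Suc -` S) = ternary (Suc -` T)"
      using Suc.prems ternary_split_head[of S] ternary_split_head[of T] by simp
    then have "n \<in> Suc -` S \<longleftrightarrow> n \<in> Suc -` T" by (rule Suc.IH)
    then show ?case by simp
  qed
  then show "S = T" if "ternary S = ternary T" for S T
    using that by blast
qed

lemma ex_injective_borel_measurable:
  assumes "countable \<B>" "\<B> \<subseteq> sets M"
    and separating: "\<And>x y. x \<in> space M \<Longrightarrow> y \<in> space M \<Longrightarrow> x \<noteq> y \<Longrightarrow> \<exists>B\<in>\<B>. x \<in> B \<longleftrightarrow> y \<notin> B"
  obtains \<tau> :: "'a \<Rightarrow> real" where "\<tau> \<in> borel_measurable M" "inj_on \<tau> (space M)"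
proof -
  define B where "B = from_nat_into (insert {} \<B>)"
  have range_B: "range B = insert {} \<B>"
    unfolding B_def using assms(1) by (intro range_from_nat_into) auto
  then have [measurable]: "B i \<in> sets M" for i
    using assms(2) by (metis insert_iff rangeI sets.empty_sets subsetD)
  define \<tau> where "\<tau> x = ternary {i. x \<in> B i}" for x
  show ?thesis
  proof (rule that)
    have "(\<lambda>x. indicator {i. x \<in> B i} i / 3 ^ i :: real) \<in> borel_measurable M" for i
    proof -
      have "(\<lambda>x. indicator (B i) x / 3 ^ i :: real) \<in> borel_measurable M" by measurable
      then show ?thesis by (simp add: indicator_def)
    qed
    then show "\<tau> \<in> borel_measurable M"
      unfolding \<tau>_def ternary_def by (intro borel_measurable_suminf)
    show "inj_on \<tau> (space M)"
    proof (rule inj_onI, rule ccontr)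
      fix x y assume xy: "x \<in> space M" "y \<in> space M" "\<tau> x = \<tau> y" "x \<noteq> y"
      have "{i. x \<in> B i} = {i. y \<in> B i}"
        using xy(3) unfolding \<tau>_def by (rule injD[OF inj_ternary])
      then have "x \<in> V \<longleftrightarrow> y \<in> V" if "V \<in> \<B>" for V
        using that range_B by (metis insertI2 mem_Collect_eq rangeE)
      then show False using separating[OF xy(1,2,4)] by blast
    qed
  qed
qed

lemma compact_metrizable_imp_second_countable:
  assumes "compact_space X" "metrizable_space X"
  shows "second_countable X"
proof -
  obtain M d where "Metric_space M d" and X: "X = Metric_space.mtopology M d"
    using assms(2) unfolding metrizable_space_def by blast
  interpret Metric_space M d by fact
  have "mtotally_bounded M"
    using assms(1) compactin_imp_mtotally_bounded by (simp add: X compact_space_def)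
  then have "\<exists>K. finite K \<and> K \<subseteq> M \<and> M \<subseteq> (\<Union>x\<in>K. mball x (1 / Suc n))" for n
    by (simp add: mtotally_bounded_def)
  then obtain K where K: "\<And>n. finite (K n)" "\<And>n. M \<subseteq> (\<Union>x\<in>K n. mball x (1 / Suc n))"
    by metis
  define \<B> where "\<B> = (\<Union>n. (\<lambda>x. mball x (1 / Suc n)) ` K n)"
  have "countable \<B>"
    unfolding \<B>_def using countable_finite[OF K(1)] by (intro countable_UN countable_image countableI_type)
  moreover have "\<forall>V\<in>\<B>. openin X V"
    by (auto simp: \<B>_def X)
  moreover have "\<exists>V\<in>\<B>. x \<in> V \<and> V \<subseteq> U" if U: "openin X U" "x \<in> U" for U x
  proof -
    obtain e where e: "0 < e" "mball x e \<subseteq> U" and "x \<in> M"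
      using U unfolding X openin_mtopology by blast
    obtain n where n: "1 / Suc n < e / 2"
      using nat_approx_posE[of "e / 2"] e(1) by auto
    obtain y where y: "y \<in> K n" "x \<in> mball y (1 / Suc n)"
      using K(2)[of n] \<open>x \<in> M\<close> by blast
    have "mball y (1 / Suc n) \<subseteq> mball x (1 / Suc n + 1 / Suc n)"
      using y by (intro mball_subset) (auto simp: commute)
    also have "\<dots> \<subseteq> mball x e"
      using n by (intro mball_subset_concentric) simp
    finally show ?thesis using y e(2) by (auto simp: \<B>_def)
  qed
  ultimately show ?thesis unfolding second_countable_def by blast
qed

lemma space_borel_of: "space (borel_of X) = topspace X"
  unfolding borel_of_def by (rule space_measure_of) (auto dest: openin_subset)

lemma sets_borel_of: "sets (borel_of X) = sigma_sets (topspace X) {U. openin X U}"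
  unfolding borel_of_def by (rule sets_measure_of) (auto dest: openin_subset)

lemma ex_injective_borel_measurable_of:
  assumes "second_countable X" "t0_space X"
  obtains \<tau> :: "'x \<Rightarrow> real" where "\<tau> \<in> borel_measurable (borel_of X)" "inj_on \<tau> (topspace X)"
proof -
  obtain \<B> where \<B>: "countable \<B>" "\<And>V. V \<in> \<B> \<Longrightarrow> openin X V"
    "\<And>U x. openin X U \<Longrightarrow> x \<in> U \<Longrightarrow> \<exists>V\<in>\<B>. x \<in> V \<and> V \<subseteq> U"
    using assms(1) unfolding second_countable_def by metis
  have separating: "\<exists>V\<in>\<B>. x \<in> V \<longleftrightarrow> y \<notin> V" if "x \<in> topspace X" "y \<in> topspace X" "x \<noteq> y" for x y
  proof -
    obtain U where "openin X U" "x \<notin> U \<longleftrightarrow> y \<in> U"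
      using assms(2) \<open>x \<in> topspace X\<close> \<open>y \<in> topspace X\<close> \<open>x \<noteq> y\<close> unfolding t0_space_def by blast
    then show ?thesis using \<B>(3) by (cases "x \<in> U") blast+
  qed
  have "\<B> \<subseteq> sets (borel_of X)"
    using \<B>(2) by (auto simp: sets_borel_of)
  then show ?thesis
    using ex_injective_borel_measurable[OF \<B>(1), of "borel_of X"] separating that
    unfolding space_borel_of by metis
qed

lemma measurable_borel_of:
  assumes "continuous_map X Y f"
  shows "f \<in> measurable (borel_of X) (borel_of Y)"
  unfolding borel_of_def[of Y]
proof (rule measurable_measure_of)
  show "f \<in> space (borel_of X) \<rightarrow> topspace Y"
    using assms by (auto simp: continuous_map_def space_borel_of)
  show "f -` U \<inter> space (borel_of X) \<in> sets (borel_of X)" if "U \<in> {U. openin Y U}" for U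
  proof -
    have "f -` U \<inter> space (borel_of X) = {x \<in> topspace X. f x \<in> U}"
      by (auto simp: space_borel_of)
    also have "openin X \<dots>"
      using assms that by (simp add: continuous_map_def)
    finally show ?thesis by (auto simp: sets_borel_of)
  qed
qed (auto dest: openin_subset)

section \<open>Laws realised on the unit interval\<close>

abbreviation unit_lborel :: "real measure" where
  "unit_lborel \<equiv> restrict_space lborel {0..1}"

lemma prob_space_unit_lborel: "prob_space unit_lborel"
  by (rule prob_spaceI) (simp add: space_restrict_space emeasure_restrict_space)

lemma AE_lborel_Icc_iff_Ioo: "AE t in lborel. t \<in> {a..b} \<longleftrightarrow> t \<in> {a<..<b}" for a b :: real
  using AE_lborel_singleton[of a] AE_lborel_singleton[of b] by eventually_elim auto

lemma AE_unit_lborel_Ioo: "AE t in unit_lborel. t \<in> {0<..<1}"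
  using AE_lborel_Icc_iff_Ioo[of 0 1] by (auto simp: AE_restrict_space_iff elim!: eventually_mono)

context cdf_distribution
begin

definition quantile :: "real \<Rightarrow> real" where
  "quantile t = (if t \<in> {0<..<1} then I t else 0)"

lemma borel_measurable_quantile: "quantile \<in> borel_measurable borel"
  unfolding quantile_def using measurable_CI
  by (subst measurable_restrict_space_iff[symmetric]) auto

lemma measurable_quantile: "quantile \<in> measurable unit_lborel borel"
  using borel_measurable_quantile by (intro measurable_restrict_space1) simp

lemma distr_quantile: "distr unit_lborel borel quantile = M"
proof -
  have "distr unit_lborel borel quantile = distr (restrict_space lborel {0<..<1}) borel I"
  proof (rule measure_eqI)
    fix A assume "A \<in> sets (distr unit_lborel borel quantile)"
    then have A: "A \<in> sets borel" by simp
    have vimage_A: "quantile -` A \<in> sets borel"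
      using measurable_sets[OF borel_measurable_quantile A] by simp
    have "emeasure (distr unit_lborel borel quantile) A = emeasure lborel (quantile -` A \<inter> {0..1})"
      using A measurable_quantile by (simp add: emeasure_distr emeasure_restrict_space space_restrict_space)
    also have "\<dots> = emeasure lborel (quantile -` A \<inter> {0<..<1})"
      using vimage_A AE_lborel_Icc_iff_Ioo[of 0 1] by (intro emeasure_eq_AE) auto
    also have "quantile -` A \<inter> {0<..<1} = I -` A \<inter> {0<..<1}"
      by (auto simp: quantile_def)
    also have "emeasure lborel \<dots> = emeasure (distr (restrict_space lborel {0<..<1}) borel I) A"
      using A measurable_CI
      by (simp add: emeasure_distr emeasure_restrict_space space_restrict_space cong: measurable_cong_sets)
    finally show "emeasure (distr unit_lborel borel quantile) A =
        emeasure (distr (restrict_space lborel {0<..<1}) borel I) A" .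
  qed simp
  then show ?thesis by (simp only: distr_I_eq_M)
qed

lemma cdf_quantile:
  assumes atomless: "\<And>x. measure M {x} = 0" and t: "t \<in> {0<..<1}"
  shows "C (quantile t) = t"
proof (rule antisym)
  have "isCont C (I t)" using isCont_cdf atomless by blast
  then have left_limit: "(C \<longlongrightarrow> C (I t)) (at_left (I t))"
    unfolding isCont_def by (rule filterlim_mono) (auto simp: at_le)
  have "eventually (\<lambda>x. x < I t) (at_left (I t))"
    by (simp add: eventually_at_filter)
  then have "eventually (\<lambda>x. C x \<le> t) (at_left (I t))"
  proof eventually_elim
    case (elim x)
    then show ?case using pseudoinverse[of t x] t by auto
  qed
  then show "C (quantile t) \<le> t"
    using tendsto_upperbound[OF left_limit] t by (simp add: quantile_def)
  show "t \<le> C (quantile t)"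
    using pseudoinverse[of t "I t"] t by (simp add: quantile_def)
qed

lemma measurable_cdf_unit_lborel: "C \<in> measurable borel unit_lborel"
  using cdf_nonneg cdf_bounded_prob measurable_C by (intro measurable_restrict_space2) auto

lemma distr_cdf:
  assumes "\<And>x. measure M {x} = 0"
  shows "distr M unit_lborel C = unit_lborel"
proof -
  have "distr M unit_lborel C = distr (distr unit_lborel borel quantile) unit_lborel C"
    by (simp only: distr_quantile)
  also have "\<dots> = distr unit_lborel unit_lborel (C \<circ> quantile)"
    using measurable_cdf_unit_lborel measurable_quantile by (rule distr_distr)
  also have "\<dots> = distr unit_lborel unit_lborel (\<lambda>t. t)"
  proof (rule distr_cong_AE)
    show "AE t in unit_lborel. (C \<circ> quantile) t = t"
      using AE_unit_lborel_Ioo by eventually_elim (simp add: cdf_quantile[OF assms])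
  qed (use measurable_cdf_unit_lborel measurable_quantile in \<open>auto intro: measurable_comp\<close>)
  also have "\<dots> = unit_lborel" by simp
  finally show ?thesis .
qed

end

lemma ex_distr_unit_lborel_countable:
  assumes "prob_space N" "sets N = Pow P" "countable P"
  obtains q where "q \<in> measurable unit_lborel N" "distr unit_lborel N q = N"
proof -
  interpret N: prob_space N by fact
  have space_N: "space N = P" using sets_eq_imp_space_eq[of N "count_space P"] assms(2) by simp
  then have P: "P \<noteq> {}" using N.not_empty by simp
  define encode :: "'a \<Rightarrow> real" where "encode = real \<circ> to_nat_on P"
  define decode :: "real \<Rightarrow> 'a" where "decode = (\<lambda>y. from_nat_into P (nat \<lfloor>y\<rfloor>))"
  have encode: "encode \<in> borel_measurable N"
    using assms(2) by (auto simp: measurable_cong_sets[of N "count_space P"])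
  have decode: "decode \<in> measurable borel N"
  proof -
    have "from_nat_into P \<in> measurable (count_space UNIV) N"
      using P assms(2) by (auto simp: space_N from_nat_into)
    then show ?thesis unfolding decode_def
      by (rule measurable_compose[rotated]) measurable
  qed
  interpret law: cdf_distribution "distr N borel encode"
    by (intro cdf_distribution.intro N.real_distribution_distr encode)
  have q: "decode \<circ> law.quantile \<in> measurable unit_lborel N"
    using law.measurable_quantile decode by (rule measurable_comp)
  have "distr unit_lborel N (decode \<circ> law.quantile) = distr (distr N borel encode) N decode"
    using distr_distr[OF decode law.measurable_quantile] by (simp only: law.distr_quantile)
  also have "\<dots> = distr N N (decode \<circ> encode)"
    using decode encode by (rule distr_distr)
  also have "\<dots> = distr N N (\<lambda>p. p)"
    using assms(3) by (intro distr_cong) (auto simp: decode_def encode_def space_N)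
  also have "\<dots> = N" by simp
  finally show ?thesis using q that by blast
qed

section \<open>Uniform measures and products\<close>

lemma measurable_uniform_count_measureI:
  "f \<in> A \<rightarrow> B \<Longrightarrow> f \<in> measurable (uniform_count_measure A) (uniform_count_measure B)"
  by (auto simp: measurable_def space_uniform_count_measure sets_uniform_count_measure)

lemma distr_uniform_count_measure_bij:
  assumes "finite A" "bij_betw f A B"
  shows "distr (uniform_count_measure A) (uniform_count_measure B) f = uniform_count_measure B"
proof (rule measure_eqI)
  fix Y assume "Y \<in> sets (distr (uniform_count_measure A) (uniform_count_measure B) f)"
  then have Y: "Y \<subseteq> B" by (simp add: sets_uniform_count_measure)
  have "f ` (f -` Y \<inter> A) = Y"
    using Y bij_betw_imp_surj_on[OF assms(2)] by auto
  then have "bij_betw f (f -` Y \<inter> A) Y"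
    using assms(2) by (intro bij_betw_subset[OF assms(2)]) auto
  then have "card (f -` Y \<inter> A) = card Y" "card A = card B" "finite B"
    using assms bij_betw_same_card bij_betw_finite by blast+
  moreover have "f \<in> measurable (uniform_count_measure A) (uniform_count_measure B)"
    using bij_betw_imp_funcset[OF assms(2)] by (rule measurable_uniform_count_measureI)
  ultimately show "emeasure (distr (uniform_count_measure A) (uniform_count_measure B) f) Y =
      emeasure (uniform_count_measure B) Y"
    using Y assms(1) by (simp add: emeasure_distr emeasure_uniform_count_measure
        space_uniform_count_measure sets_uniform_count_measure)
qed simp

lemma AE_pair_snd:
  assumes "sigma_finite_measure N" "AE y in N. P y"
  shows "AE z in M \<Otimes>\<^sub>M N. P (snd z)"
proof -
  interpret N: sigma_finite_measure N by fact
  obtain Z where Z: "{y \<in> space N. \<not> P y} \<subseteq> Z" "emeasure N Z = 0" "Z \<in> sets N"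
    using assms(2) by (rule AE_E)
  show ?thesis
  proof (rule AE_I)
    show "emeasure (M \<Otimes>\<^sub>M N) (space M \<times> Z) = 0"
      using Z by (simp add: N.emeasure_pair_measure_Times)
  qed (use Z in \<open>auto simp: space_pair_measure\<close>)
qed

section \<open>Measure-preserving actions of finite groups\<close>

lemma (in group) bij_betw_mult_left:
  "g \<in> carrier G \<Longrightarrow> bij_betw (\<lambda>h. g \<otimes> h) (carrier G) (carrier G)"
  by (simp add: bij_betw_def inj_on_cmult surj_const_mult)

lemma (in group) bij_betw_mult_right:
  "g \<in> carrier G \<Longrightarrow> bij_betw (\<lambda>h. h \<otimes> g) (carrier G) (carrier G)"
  by (rule bij_betwI[where g = "\<lambda>h. h \<otimes> inv g"]) (auto simp: m_assoc)

lemma (in group) group_actionI: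
  assumes extensional: "\<And>g. g \<in> carrier G \<Longrightarrow> \<phi> g \<in> extensional E"
    and closed: "\<And>g x. g \<in> carrier G \<Longrightarrow> x \<in> E \<Longrightarrow> \<phi> g x \<in> E"
    and one: "\<And>x. x \<in> E \<Longrightarrow> \<phi> \<one> x = x"
    and mult: "\<And>g h x. g \<in> carrier G \<Longrightarrow> h \<in> carrier G \<Longrightarrow> x \<in> E \<Longrightarrow> \<phi> (g \<otimes> h) x = \<phi> g (\<phi> h x)"
  shows "group_action G E \<phi>"
proof -
  have "bij_betw (\<phi> g) E E" if "g \<in> carrier G" for g
  proof (rule bij_betwI[where g = "\<phi> (inv g)"])
    show "\<phi> (inv g) (\<phi> g x) = x" "\<phi> g (\<phi> (inv g) x) = x" if "x \<in> E" for x
      using that \<open>g \<in> carrier G\<close> mult[of "inv g" g x] mult[of g "inv g" x] one by simp_all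
  qed (use that closed in auto)
  then have Bij: "\<phi> g \<in> Bij E" if "g \<in> carrier G" for g
    using that extensional by (simp add: Bij_def)
  have "\<phi> \<in> hom G (BijGroup E)"
  proof (rule homI)
    fix g h assume gh: "g \<in> carrier G" "h \<in> carrier G"
    have "\<phi> (g \<otimes> h) = compose E (\<phi> g) (\<phi> h)"
      using gh mult by (intro extensionalityI[OF extensional compose_extensional]) (auto simp: compose_eq)
    then show "\<phi> (g \<otimes> h) = \<phi> g \<otimes>\<^bsub>BijGroup E\<^esub> \<phi> h"
      using gh Bij by (simp add: BijGroup_def)
  qed (use Bij in \<open>simp add: BijGroup_def\<close>)
  then show ?thesis
    by (intro group_action.intro group_hom.intro group_hom_axioms.intro group_BijGroup is_group)
qed

abbreviation haar :: "('g, 'm) monoid_scheme \<Rightarrow> 'g measure" where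
  "haar G \<equiv> uniform_count_measure (carrier G)"

lemma (in group) prob_space_haar: "finite (carrier G) \<Longrightarrow> prob_space (haar G)"
  by (rule prob_space_uniform_count_measure) auto

lemma measurable_haar_pairI:
  assumes "finite (carrier G)" "\<And>h. h \<in> carrier G \<Longrightarrow> (\<lambda>x. f (h, x)) \<in> measurable M N"
  shows "f \<in> measurable (haar G \<Otimes>\<^sub>M M) N"
proof -
  have sets_eq: "sets (haar G \<Otimes>\<^sub>M M) = sets (count_space (carrier G) \<Otimes>\<^sub>M M)"
    by (intro sets_pair_measure_cong sets_uniform_count_measure_count_space refl)
  then show ?thesis
    using measurable_pair_measure_countable1[of "carrier G" f M N] assms
    by (simp add: measurable_cong_sets[OF sets_eq refl] countable_finite)
qed

locale finite_pmp_action = prob_space M + group_action G "space M" \<phi>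
  for G :: "('g, 'm) monoid_scheme" (structure) and M :: "'x measure" and \<phi> +
  assumes finite_carrier: "finite (carrier G)"
    and measurable_action: "g \<in> carrier G \<Longrightarrow> \<phi> g \<in> measurable M M"
    and distr_action: "g \<in> carrier G \<Longrightarrow> distr M M (\<phi> g) = M"
begin

sublocale group G
  using group_hom group_hom.axioms(1) by auto

sublocale haar: prob_space "haar G"
  using finite_carrier by (rule prob_space_haar)

sublocale haar_pair: pair_prob_space "haar G" M ..

lemma action_closed: "g \<in> carrier G \<Longrightarrow> x \<in> space M \<Longrightarrow> \<phi> g x \<in> space M"
  using element_image by blast

lemma action_one: "x \<in> space M \<Longrightarrow> \<phi> \<one> x = x"
  using id_eq_one by (metis restrict_apply')

lemma action_inv:
  assumes "g \<in> carrier G" "x \<in> space M"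
  shows "\<phi> (inv g) (\<phi> g x) = x" "\<phi> g (\<phi> (inv g) x) = x"
  using assms orbit_sym_aux[of g x] orbit_sym_aux[of "inv g" x] by auto

lemma AE_action:
  assumes "AE x in M. P x"
  shows "AE x in M. \<forall>g\<in>carrier G. P (\<phi> g x)"
proof (rule AE_finite_allI[OF finite_carrier])
  show "AE x in M. P (\<phi> g x)" if "g \<in> carrier G" for g
    using AE_distrD[OF measurable_action[OF that], of P] assms unfolding distr_action[OF that] by blast
qed

lemma measurable_pair_action: "(\<lambda>(h, x). \<phi> h x) \<in> measurable (haar G \<Otimes>\<^sub>M M) M"
  using finite_carrier measurable_action by (intro measurable_haar_pairI) auto

lemma distr_pair_action: "distr (haar G \<Otimes>\<^sub>M M) M (\<lambda>(h, x). \<phi> h x) = M"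
proof (rule measure_eqI)
  fix A assume "A \<in> sets (distr (haar G \<Otimes>\<^sub>M M) M (\<lambda>(h, x). \<phi> h x))"
  then have A: "A \<in> sets M" by simp
  let ?E = "(\<lambda>(h, x). \<phi> h x) -` A \<inter> space (haar G \<Otimes>\<^sub>M M)"
  have slice: "emeasure M (Pair h -` ?E) = emeasure M A" if h: "h \<in> carrier G" for h
  proof -
    have "Pair h -` ?E = \<phi> h -` A \<inter> space M"
      using h by (auto simp: space_pair_measure space_uniform_count_measure)
    then show ?thesis
      using emeasure_distr[OF measurable_action[OF h] A] by (simp add: distr_action h)
  qed
  have "emeasure (distr (haar G \<Otimes>\<^sub>M M) M (\<lambda>(h, x). \<phi> h x)) A = emeasure (haar G \<Otimes>\<^sub>M M) ?E"
    using measurable_pair_action A by (rule emeasure_distr)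
  also have "\<dots> = (\<integral>\<^sup>+ h. emeasure M (Pair h -` ?E) \<partial>haar G)"
    using measurable_sets[OF measurable_pair_action A] by (rule emeasure_pair_measure_alt)
  also have "\<dots> = (\<integral>\<^sup>+ h. emeasure M A \<partial>haar G)"
    using slice by (intro nn_integral_cong) (simp add: space_uniform_count_measure)
  also have "\<dots> = emeasure M A"
    by (simp add: haar.emeasure_space_1)
  finally show "emeasure (distr (haar G \<Otimes>\<^sub>M M) M (\<lambda>(h, x). \<phi> h x)) A = emeasure M A" .
qed simp

lemma measurable_haar_pair_mult:
  assumes "\<rho> \<in> measurable M (haar G)"
  shows "(\<lambda>(h, x). (h \<otimes> \<rho> x, x)) \<in> measurable (haar G \<Otimes>\<^sub>M M) (haar G \<Otimes>\<^sub>M M)"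
proof (rule measurable_haar_pairI[OF finite_carrier])
  fix h assume h: "h \<in> carrier G"
  have "(\<lambda>k. h \<otimes> k) \<in> measurable (haar G) (haar G)"
    using h by (intro measurable_uniform_count_measureI) simp
  then have "(\<lambda>x. h \<otimes> \<rho> x) \<in> measurable M (haar G)"
    using assms by (rule measurable_compose[rotated])
  then show "(\<lambda>x. case (h, x) of (h, x) \<Rightarrow> (h \<otimes> \<rho> x, x)) \<in> measurable M (haar G \<Otimes>\<^sub>M M)"
    by simp
qed

lemma distr_haar_pair_mult:
  assumes \<rho>: "\<rho> \<in> measurable M (haar G)"
  shows "distr (haar G \<Otimes>\<^sub>M M) (haar G \<Otimes>\<^sub>M M) (\<lambda>(h, x). (h \<otimes> \<rho> x, x)) = haar G \<Otimes>\<^sub>M M"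
    (is "distr ?P ?P ?T = ?P")
proof (rule measure_eqI)
  fix E assume "E \<in> sets (distr ?P ?P ?T)"
  then have E: "E \<in> sets ?P" by simp
  have T: "?T \<in> measurable ?P ?P" using \<rho> by (rule measurable_haar_pair_mult)
  have slice: "emeasure (haar G) ((\<lambda>h. (h, x)) -` (?T -` E \<inter> space ?P)) = emeasure (haar G) ((\<lambda>h. (h, x)) -` E)"
    if x: "x \<in> space M" for x
  proof -
    have \<rho>x: "\<rho> x \<in> carrier G"
      using measurable_space[OF \<rho> x] by (simp add: space_uniform_count_measure)
    then have right_mult: "(\<lambda>h. h \<otimes> \<rho> x) \<in> measurable (haar G) (haar G)"
      by (intro measurable_uniform_count_measureI) simp
    have "(\<lambda>h. (h, x)) -` (?T -` E \<inter> space ?P) = (\<lambda>h. h \<otimes> \<rho> x) -` ((\<lambda>h. (h, x)) -` E) \<inter> space (haar G)"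
      using x by (auto simp: space_pair_measure)
    then show ?thesis
      using emeasure_distr[OF right_mult sets_Pair2[OF E, of x]]
      by (simp add: distr_uniform_count_measure_bij[OF finite_carrier bij_betw_mult_right[OF \<rho>x]])
  qed
  have "emeasure (distr ?P ?P ?T) E = emeasure ?P (?T -` E \<inter> space ?P)"
    using T E by (rule emeasure_distr)
  also have "\<dots> = (\<integral>\<^sup>+ x. emeasure (haar G) ((\<lambda>h. (h, x)) -` (?T -` E \<inter> space ?P)) \<partial>M)"
    using measurable_sets[OF T E] by (rule haar_pair.emeasure_pair_measure_alt2)
  also have "\<dots> = (\<integral>\<^sup>+ x. emeasure (haar G) ((\<lambda>h. (h, x)) -` E) \<partial>M)"
    using slice by (rule nn_integral_cong)
  also have "\<dots> = emeasure ?P E"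
    using E by (rule haar_pair.emeasure_pair_measure_alt2[symmetric])
  finally show "emeasure (distr ?P ?P ?T) E = emeasure ?P E" .
qed simp

lemma distr_equivariant_invariant:
  assumes \<rho>: "\<rho> \<in> measurable M (haar G)" and m: "m \<in> measurable M N"
    and equivariant: "AE x in M. \<forall>g\<in>carrier G. \<rho> (\<phi> g x) = g \<otimes> \<rho> x"
    and invariant: "AE x in M. \<forall>g\<in>carrier G. m (\<phi> g x) = m x"
  shows "distr M (haar G \<Otimes>\<^sub>M N) (\<lambda>x. (\<rho> x, m x)) = haar G \<Otimes>\<^sub>M distr M N m"
proof -
  let ?P = "haar G \<Otimes>\<^sub>M M" and ?Q = "haar G \<Otimes>\<^sub>M N"
  let ?T = "\<lambda>(h, x). (h \<otimes> \<rho> x, x)"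
  have \<rho>m: "(\<lambda>x. (\<rho> x, m x)) \<in> measurable M ?Q" using \<rho> m by measurable
  have m': "(\<lambda>(h, x). (h, m x)) \<in> measurable ?P ?Q" using m by measurable
  have T: "?T \<in> measurable ?P ?P" using \<rho> by (rule measurable_haar_pair_mult)
  have "distr M ?Q (\<lambda>x. (\<rho> x, m x)) = distr (distr ?P M (\<lambda>(h, x). \<phi> h x)) ?Q (\<lambda>x. (\<rho> x, m x))"
    by (simp only: distr_pair_action)
  also have "\<dots> = distr ?P ?Q ((\<lambda>x. (\<rho> x, m x)) \<circ> (\<lambda>(h, x). \<phi> h x))"
    using \<rho>m measurable_pair_action by (rule distr_distr)
  also have "\<dots> = distr ?P ?Q ((\<lambda>(h, x). (h, m x)) \<circ> ?T)"
  proof (rule distr_cong_AE)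
    have "AE x in M. \<forall>g\<in>carrier G. \<rho> (\<phi> g x) = g \<otimes> \<rho> x \<and> m (\<phi> g x) = m x"
      using equivariant invariant by eventually_elim simp
    from AE_pair_snd[OF sigma_finite_measure_axioms this, of "haar G"] AE_space[of ?P]
    show "AE z in ?P. ((\<lambda>x. (\<rho> x, m x)) \<circ> (\<lambda>(h, x). \<phi> h x)) z = ((\<lambda>(h, x). (h, m x)) \<circ> ?T) z"
    proof eventually_elim
      case (elim z)
      obtain h x where z: "z = (h, x)" by (cases z)
      then have "h \<in> carrier G"
        using elim(2) by (simp add: space_pair_measure space_uniform_count_measure)
      then show ?case using elim(1) by (simp add: z)
    qed
  qed (rule refl measurable_comp[OF measurable_pair_action \<rho>m] measurable_comp[OF T m'])+
  also have "\<dots> = distr (distr ?P ?P ?T) ?Q (\<lambda>(h, x). (h, m x))"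
    using m' T by (rule distr_distr[symmetric])
  also have "\<dots> = distr (haar G) (haar G) (\<lambda>h. h) \<Otimes>\<^sub>M distr M N m"
    unfolding distr_haar_pair_mult[OF \<rho>]
    using m prob_space_distr[OF m]
    by (intro pair_measure_distr[symmetric]) (auto simp: prob_space_imp_sigma_finite)
  finally show ?thesis by simp
qed

lemma finite_pmp_action_completion: "finite_pmp_action G (completion M) \<phi>"
proof -
  have measurable: "\<phi> g \<in> measurable (completion M) (completion M)"
    and distr: "distr (completion M) (completion M) (\<phi> g) = completion M" if g: "g \<in> carrier G" for g
  proof -
    have \<phi>g: "\<phi> g \<in> measurable (completion M) M"
      using measurable_action[OF g] by (rule measurable_completion)
    have distr_\<phi>g: "distr (completion M) M (\<phi> g) = M"
      using distr_completion[OF measurable_action[OF g]] by (simp add: distr_action g)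
    then show "\<phi> g \<in> measurable (completion M) (completion M)"
      using \<phi>g by (intro completion.measurable_completion2) simp_all
    show "distr (completion M) (completion M) (\<phi> g) = completion M"
      using completion.completion_distr_eq[OF \<phi>g] by (simp add: distr_\<phi>g)
  qed
  have "prob_space (completion M)"
    by (rule prob_spaceI) (simp add: emeasure_space_1)
  then show ?thesis
    using group_action_axioms finite_carrier measurable distr
    by (intro finite_pmp_action.intro finite_pmp_action_axioms.intro) auto
qed

end

section \<open>Colour patterns\<close>

definition pattern :: "('g, 'm) monoid_scheme \<Rightarrow> ('g \<Rightarrow> 'x \<Rightarrow> 'x) \<Rightarrow> ('x \<Rightarrow> nat) \<Rightarrow> 'x \<Rightarrow> 'g \<Rightarrow> nat" where
  "pattern G \<phi> f x = (\<lambda>h\<in>carrier G. f (\<phi> h x))"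

abbreviation pattern_space :: "('g, 'm) monoid_scheme \<Rightarrow> nat \<Rightarrow> ('g \<Rightarrow> nat) measure" where
  "pattern_space G r \<equiv> PiM (carrier G) (\<lambda>_. count_space {..<r})"

definition pattern_law ::
    "('g, 'm) monoid_scheme \<Rightarrow> ('g \<Rightarrow> 'x \<Rightarrow> 'x) \<Rightarrow> 'x measure \<Rightarrow> nat \<Rightarrow> ('x \<Rightarrow> nat) \<Rightarrow> ('g \<Rightarrow> nat) measure" where
  "pattern_law G \<phi> M r f = distr M (pattern_space G r) (pattern G \<phi> f)"

definition pattern_laws ::
    "('g, 'm) monoid_scheme \<Rightarrow> ('g \<Rightarrow> 'x \<Rightarrow> 'x) \<Rightarrow> 'x measure \<Rightarrow> nat \<Rightarrow> ('g \<Rightarrow> nat) measure set" where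
  "pattern_laws G \<phi> M r = pattern_law G \<phi> M r ` measurable M (count_space {..<r})"

definition mono_patterns :: "('g, 'm) monoid_scheme \<Rightarrow> nat \<Rightarrow> 'g \<Rightarrow> nat \<Rightarrow> ('g \<Rightarrow> nat) set" where
  "mono_patterns G r g c = {p \<in> carrier G \<rightarrow>\<^sub>E {..<r}. \<forall>h\<in>generate G {g}. p h = c}"

definition largest_mono :: "('g, 'm) monoid_scheme \<Rightarrow> nat \<Rightarrow> ('g \<Rightarrow> nat) measure \<Rightarrow> ennreal" where
  "largest_mono G r N =
     (SUP (g, c) \<in> (carrier G - {\<one>\<^bsub>G\<^esub>}) \<times> {..<r}. emeasure N (mono_patterns G r g c))"

lemma pattern_space_eq_count_space:
  "finite (carrier G) \<Longrightarrow> pattern_space G r = count_space (carrier G \<rightarrow>\<^sub>E {..<r})"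
  by (rule count_space_PiM_finite) simp_all

lemma sets_mono_patterns:
  "finite (carrier G) \<Longrightarrow> mono_patterns G r g c \<in> sets (pattern_space G r)"
  by (auto simp: pattern_space_eq_count_space mono_patterns_def)

context finite_pmp_action
begin

lemma measurable_pattern:
  assumes "f \<in> measurable M (count_space {..<r})"
  shows "pattern G \<phi> f \<in> measurable M (pattern_space G r)"
  unfolding pattern_def using measurable_compose[OF measurable_action assms]
  by (intro measurable_restrict)

definition mono_part :: "('x \<Rightarrow> nat) \<Rightarrow> 'g \<Rightarrow> nat \<Rightarrow> 'x set" where
  "mono_part f g c = {x \<in> space M. \<forall>h\<in>generate G {g}. f (\<phi> h x) = c}"

lemma vimage_mono_patterns:
  assumes f: "f \<in> measurable M (count_space {..<r})" and g: "g \<in> carrier G"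
  shows "pattern G \<phi> f -` mono_patterns G r g c \<inter> space M = mono_part f g c"
proof -
  have "pattern G \<phi> f x \<in> carrier G \<rightarrow>\<^sub>E {..<r}" if "x \<in> space M" for x
    using measurable_space[OF f] action_closed that by (auto simp: pattern_def)
  then show ?thesis
    using generate_in_carrier[of "{g}"] g by (auto simp: mono_patterns_def mono_part_def pattern_def)
qed

lemma sets_mono_part:
  assumes "f \<in> measurable M (count_space {..<r})" "g \<in> carrier G"
  shows "mono_part f g c \<in> sets M"
  unfolding vimage_mono_patterns[OF assms, symmetric]
  using measurable_pattern[OF assms(1)] sets_mono_patterns[OF finite_carrier] by (rule measurable_sets)

lemma emeasure_pattern_law:
  assumes "f \<in> measurable M (count_space {..<r})" "g \<in> carrier G"
  shows "emeasure (pattern_law G \<phi> M r f) (mono_patterns G r g c) = emeasure M (mono_part f g c)"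
  unfolding pattern_law_def vimage_mono_patterns[OF assms, symmetric]
  using measurable_pattern[OF assms(1)] sets_mono_patterns[OF finite_carrier]
  by (rule emeasure_distr)

lemma mono_part_colour: "x \<in> mono_part f g c \<Longrightarrow> f x = c"
  using generate.one[of G "{g}"] action_one by (auto simp: mono_part_def)

lemma invariant_mono_subset_mono_part:
  assumes g: "g \<in> carrier G" and A: "A \<subseteq> space M" "A = \<phi> g ` A" "\<forall>x\<in>A. f x = c"
  shows "A \<subseteq> mono_part f g c"
proof -
  have "\<phi> h x \<in> A" if "h \<in> generate G {g}" "x \<in> A" for h x
    using that
  proof (induction arbitrary: x rule: generate.induct)
    case one
    then show ?case using A(1) action_one by auto
  next
    case (incl h)
    then show ?case using A(2) by auto
  next
    case (inv h)
    then obtain y where "y \<in> A" "x = \<phi> g y" using A(2) by auto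
    then show ?case using inv A(1) g action_inv(1)[of g y] by auto
  next
    case (eng h1 h2)
    then show ?case
      using composition_rule[of x h1 h2] generate_in_carrier[of "{g}"] g A(1) by auto
  qed
  then show ?thesis using A(1,3) by (auto simp: mono_part_def)
qed

lemma image_mono_part:
  assumes g: "g \<in> carrier G"
  shows "\<phi> g ` mono_part f g c = mono_part f g c" (is "_ ` ?A = ?A")
proof
  have orbit_subset: "\<phi> h x \<in> ?A" if h: "h \<in> generate G {g}" and x: "x \<in> ?A" for h x
  proof -
    have "h \<in> carrier G" using generate_in_carrier[of "{g}" h] g h by simp
    moreover have "f (\<phi> k (\<phi> h x)) = c" if k: "k \<in> generate G {g}" for k
    proof -
      have "\<phi> k (\<phi> h x) = \<phi> (k \<otimes> h) x"
        using composition_rule[of x k h] generate_in_carrier[of "{g}" k] g k \<open>h \<in> carrier G\<close> x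
        by (simp add: mono_part_def)
      then show ?thesis
        using generate.eng[OF k h] x by (simp add: mono_part_def)
    qed
    ultimately show ?thesis
      using x action_closed by (simp add: mono_part_def)
  qed
  show "\<phi> g ` ?A \<subseteq> ?A"
    using orbit_subset[OF generate.incl[of g]] by auto
  show "?A \<subseteq> \<phi> g ` ?A"
  proof
    fix x assume x: "x \<in> ?A"
    then have "x = \<phi> g (\<phi> (inv g) x)"
      using g action_inv(2)[of g x] by (simp add: mono_part_def)
    moreover have "\<phi> (inv g) x \<in> ?A"
      using x by (intro orbit_subset generate.inv) auto
    ultimately show "x \<in> \<phi> g ` ?A" by (rule image_eqI)
  qed
qed

lemma emeasure_invariant_mono_le_largest_mono:
  assumes f: "f \<in> measurable M (count_space {..<r})" and g: "g \<in> carrier G" "g \<noteq> \<one>"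
    and A: "A \<in> sets M" "A = \<phi> g ` A" "\<forall>x\<in>A. f x = c"
  shows "emeasure M A \<le> largest_mono G r (pattern_law G \<phi> M r f)"
proof (cases "A = {}")
  case False
  have AM: "A \<subseteq> space M" using A(1) by (rule sets.sets_into_space)
  then have "c < r" using False A(3) measurable_space[OF f] by fastforce
  have "emeasure M A \<le> emeasure M (mono_part f g c)"
    using invariant_mono_subset_mono_part[OF g(1) AM A(2,3)] sets_mono_part[OF f g(1)]
    by (rule emeasure_mono)
  also have "\<dots> = emeasure (pattern_law G \<phi> M r f) (mono_patterns G r g c)"
    using f g(1) by (rule emeasure_pattern_law[symmetric])
  also have "\<dots> \<le> largest_mono G r (pattern_law G \<phi> M r f)"
    unfolding largest_mono_def using g \<open>c < r\<close> by (intro SUP_upper2[of "(g, c)"]) auto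
  finally show ?thesis .
qed simp

lemma ex_invariant_mono_eq_largest_mono:
  assumes f: "f \<in> measurable M (count_space {..<r})"
    and pos: "0 < largest_mono G r (pattern_law G \<phi> M r f)"
  obtains A c g where "A \<in> sets M" "\<forall>x\<in>A. f x = c" "g \<in> carrier G" "g \<noteq> \<one>" "A = \<phi> g ` A"
    "emeasure M A = largest_mono G r (pattern_law G \<phi> M r f)"
proof -
  let ?I = "(carrier G - {\<one>}) \<times> {..<r}"
  let ?F = "\<lambda>(g, c). emeasure (pattern_law G \<phi> M r f) (mono_patterns G r g c)"
  have "?I \<noteq> {}"
    using pos unfolding largest_mono_def by (metis SUP_empty bot_ennreal less_irrefl)
  moreover have "finite ?I" using finite_carrier by simp
  ultimately have "largest_mono G r (pattern_law G \<phi> M r f) \<in> ?F ` ?I"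
    unfolding largest_mono_def by (subst cSup_eq_Max) (auto intro!: Max_in simp del: Sigma_empty2)
  then obtain g c where g: "g \<in> carrier G" "g \<noteq> \<one>"
    and max: "largest_mono G r (pattern_law G \<phi> M r f) = ?F (g, c)" by force
  show ?thesis
  proof (rule that)
    show "mono_part f g c \<in> sets M"
      using f g(1) by (rule sets_mono_part)
    show "\<forall>x\<in>mono_part f g c. f x = c"
      using mono_part_colour by blast
    show "mono_part f g c = \<phi> g ` mono_part f g c"
      using image_mono_part[OF g(1)] by (rule sym)
    show "emeasure M (mono_part f g c) = largest_mono G r (pattern_law G \<phi> M r f)"
      using emeasure_pattern_law[OF f g(1)] by (simp add: max)
  qed (rule g)+
qed

lemma ms_eq_Sup_completion:
  "ms G \<phi> M r = Sup {\<epsilon>. 0 < \<epsilon> \<and> (\<forall>N\<in>pattern_laws G \<phi> (completion M) r. \<epsilon> \<le> largest_mono G r N)}"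
proof -
  interpret completion: finite_pmp_action G "completion M" \<phi>
    by (rule finite_pmp_action_completion)
  have "(\<exists>A\<in>sets (completion M). (\<exists>c. \<forall>x\<in>A. f x = c) \<and> \<epsilon> \<le> emeasure (completion M) A \<and>
        (\<exists>g\<in>carrier G. g \<noteq> \<one> \<and> A = \<phi> g ` A)) \<longleftrightarrow>
      \<epsilon> \<le> largest_mono G r (pattern_law G \<phi> (completion M) r f)" (is "?L \<longleftrightarrow> ?R")
    if f: "f \<in> measurable (completion M) (count_space {..<r})" and "0 < \<epsilon>" for f \<epsilon>
  proof
    assume ?L
    then show ?R
      using completion.emeasure_invariant_mono_le_largest_mono[OF f] by (meson order_trans)
  next
    assume ?R
    then have "0 < largest_mono G r (pattern_law G \<phi> (completion M) r f)"
      using \<open>0 < \<epsilon>\<close> by (rule less_le_trans[rotated])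
    then obtain A c g where "A \<in> sets (completion M)" "\<forall>x\<in>A. f x = c" "g \<in> carrier G" "g \<noteq> \<one>" "A = \<phi> g ` A"
      "emeasure (completion M) A = largest_mono G r (pattern_law G \<phi> (completion M) r f)"
      using completion.ex_invariant_mono_eq_largest_mono[OF f] by metis
    then show ?L using \<open>?R\<close> by (intro bexI[of _ A] conjI exI[of _ c] bexI[of _ g]) simp_all
  qed
  then show ?thesis
    unfolding ms_def pattern_laws_def by (intro arg_cong[of _ _ Sup]) auto
qed

lemma completion_ex_measurable_colouring:
  fixes f :: "'x \<Rightarrow> nat"
  assumes f: "f \<in> measurable (completion M) (count_space {..<r})"
  obtains f' where "f' \<in> measurable M (count_space {..<r})" "AE x in M. f x = f' x"
proof -
  obtain x where "x \<in> space M" using not_empty by auto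
  then have "0 < r" using measurable_space[OF f, of x] by auto
  have "simple_function (completion M) f"
    using f by (auto simp: simple_function_def measurable_count_space_eq2 Pi_iff
        intro!: finite_subset[of "f ` space M" "{..<r}"])
  then obtain h where h: "simple_function M h" "AE x in M. f x = h x"
    using completion_ex_simple_function by blast
  define f' where "f' x = (if h x < r then h x else 0)" for x
  have "f' \<in> measurable M (count_space UNIV)"
    unfolding f'_def using measurable_simple_function[OF h(1)] by measurable
  then have "f' \<in> measurable M (count_space {..<r})"
    using \<open>0 < r\<close> by (auto simp: f'_def measurable_def)
  moreover have "AE x in M. f x = f' x"
    using h(2) AE_space
  proof eventually_elim
    case (elim x)
    then show ?case using measurable_space[OF f, of x] by (simp add: f'_def)
  qed
  ultimately show ?thesis by (rule that)
qed

lemma pattern_law_completion: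
  assumes f: "f \<in> measurable (completion M) (count_space {..<r})"
    and f': "f' \<in> measurable M (count_space {..<r})"
    and eq: "AE x in M. f x = f' x"
  shows "pattern_law G \<phi> (completion M) r f = pattern_law G \<phi> M r f'"
proof -
  interpret completion: finite_pmp_action G "completion M" \<phi>
    by (rule finite_pmp_action_completion)
  have "AE x in M. pattern G \<phi> f x = pattern G \<phi> f' x"
    using AE_action[OF eq] by eventually_elim (auto simp: pattern_def)
  then have "pattern_law G \<phi> (completion M) r f = distr (completion M) (pattern_space G r) (pattern G \<phi> f')"
    unfolding pattern_law_def
    using completion.measurable_pattern[OF f] measurable_completion[OF measurable_pattern[OF f']]
    by (intro distr_cong_AE AE_completion refl)
  then show ?thesis
    by (simp only: pattern_law_def distr_completion[OF measurable_pattern[OF f']])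
qed

lemma pattern_laws_completion: "pattern_laws G \<phi> (completion M) r = pattern_laws G \<phi> M r"
proof (intro equalityI subsetI)
  fix N assume "N \<in> pattern_laws G \<phi> (completion M) r"
  then obtain f where f: "f \<in> measurable (completion M) (count_space {..<r})"
    and N: "N = pattern_law G \<phi> (completion M) r f"
    unfolding pattern_laws_def by blast
  obtain f' where f': "f' \<in> measurable M (count_space {..<r})" "AE x in M. f x = f' x"
    using completion_ex_measurable_colouring[OF f] .
  then show "N \<in> pattern_laws G \<phi> M r"
    by (simp add: N pattern_law_completion[OF f f'] pattern_laws_def)
next
  fix N assume "N \<in> pattern_laws G \<phi> M r"
  then obtain f where f: "f \<in> measurable M (count_space {..<r})" and N: "N = pattern_law G \<phi> M r f"
    unfolding pattern_laws_def by blast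
  then have "N = pattern_law G \<phi> (completion M) r f"
    using pattern_law_completion[OF measurable_completion[OF f] f] by simp
  then show "N \<in> pattern_laws G \<phi> (completion M) r"
    using measurable_completion[OF f] by (simp add: pattern_laws_def)
qed

theorem ms_eq_INF_largest_mono: "ms G \<phi> M r = (INF N\<in>pattern_laws G \<phi> M r. largest_mono G r N)"
proof -
  have "Sup {\<epsilon>. 0 < \<epsilon> \<and> \<epsilon> \<le> b} = b" for b :: ennreal
  proof (rule Sup_eqI)
    show "b \<le> y" if "\<And>\<epsilon>. \<epsilon> \<in> {\<epsilon>. 0 < \<epsilon> \<and> \<epsilon> \<le> b} \<Longrightarrow> \<epsilon> \<le> y" for y
      using that[of b] by (cases "b = 0") (auto simp: zero_less_iff_neq_zero)
  qed simp
  then show ?thesis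
    unfolding ms_eq_Sup_completion pattern_laws_completion by (simp flip: le_INF_iff)
qed

end

lemma ms_antimono_pattern_laws:
  assumes "finite_pmp_action G M \<phi>" "finite_pmp_action G M' \<phi>'"
    and "pattern_laws G \<phi>' M' r \<subseteq> pattern_laws G \<phi> M r"
  shows "ms G \<phi> M r \<le> ms G \<phi>' M' r"
  unfolding assms(1,2)[THEN finite_pmp_action.ms_eq_INF_largest_mono]
  using assms(3) by (rule INF_superset_mono) simp

lemma pattern_laws_factor_subset:
  assumes M: "finite_pmp_action G M \<phi>" and M': "finite_pmp_action G M' \<phi>'"
    and T: "T \<in> measurable M M'" "distr M M' T = M'"
    and equivariant: "AE x in M. \<forall>g\<in>carrier G. T (\<phi> g x) = \<phi>' g (T x)"
  shows "pattern_laws G \<phi>' M' r \<subseteq> pattern_laws G \<phi> M r"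
proof
  interpret M: finite_pmp_action G M \<phi> by fact
  interpret M': finite_pmp_action G M' \<phi>' by fact
  fix N assume "N \<in> pattern_laws G \<phi>' M' r"
  then obtain f where f: "f \<in> measurable M' (count_space {..<r})" and N: "N = pattern_law G \<phi>' M' r f"
    unfolding pattern_laws_def by blast
  have fT: "f \<circ> T \<in> measurable M (count_space {..<r})"
    using T(1) f by (rule measurable_comp)
  have "AE x in M. pattern G \<phi> (f \<circ> T) x = (pattern G \<phi>' f \<circ> T) x"
    using equivariant by eventually_elim (auto simp: pattern_def)
  then have "pattern_law G \<phi> M r (f \<circ> T) = distr M (pattern_space G r) (pattern G \<phi>' f \<circ> T)"
    unfolding pattern_law_def
    using M.measurable_pattern[OF fT] measurable_comp[OF T(1) M'.measurable_pattern[OF f]]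
    by (intro distr_cong_AE refl)
  also have "\<dots> = distr (distr M M' T) (pattern_space G r) (pattern G \<phi>' f)"
    using M'.measurable_pattern[OF f] T(1) by (rule distr_distr[symmetric])
  also have "\<dots> = N"
    by (simp only: T(2) N pattern_law_def)
  finally show "N \<in> pattern_laws G \<phi> M r"
    using fT by (auto simp: pattern_laws_def)
qed

section \<open>The cylinder\<close>

lemma space_cylinder_measure: "space (cylinder_measure G) = carrier G \<times> {0..1}"
  by (simp add: cylinder_measure_def space_pair_measure space_uniform_count_measure space_restrict_space)

lemma cylinder_action_apply:
  "h \<in> carrier G \<Longrightarrow> t \<in> {0..1} \<Longrightarrow> cylinder_action G g (h, t) = (g \<otimes>\<^bsub>G\<^esub> h, t)"
  by (simp add: cylinder_action_def)

lemma (in group) group_action_cylinder_action: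
  "group_action G (space (cylinder_measure G)) (cylinder_action G)"
proof (rule group_actionI)
  show "cylinder_action G g \<in> extensional (space (cylinder_measure G))" for g
    by (simp add: cylinder_action_def space_cylinder_measure)
qed (auto simp: space_cylinder_measure cylinder_action_apply m_assoc)

lemma (in group) finite_pmp_action_cylinder:
  assumes fin: "finite (carrier G)"
  shows "finite_pmp_action G (cylinder_measure G) (cylinder_action G)"
proof -
  interpret haar: prob_space "haar G" using fin by (rule prob_space_haar)
  interpret unit: prob_space unit_lborel by (rule prob_space_unit_lborel)
  interpret pair_prob_space "haar G" unit_lborel ..
  let ?C = "haar G \<Otimes>\<^sub>M unit_lborel"
  have cylinder: "cylinder_measure G = ?C" by (rule cylinder_measure_def)
  have "cylinder_action G g \<in> measurable ?C ?C" and "distr ?C ?C (cylinder_action G g) = ?C"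
    if g: "g \<in> carrier G" for g
  proof -
    have left_mult: "(\<lambda>h. g \<otimes> h) \<in> measurable (haar G) (haar G)"
      using g by (intro measurable_uniform_count_measureI) simp
    have action_eq: "cylinder_action G g z = (case z of (h, t) \<Rightarrow> (g \<otimes> h, t))" if "z \<in> space ?C" for z
      using that space_cylinder_measure[of G] by (auto simp: cylinder cylinder_action_apply)
    have "(\<lambda>(h, t). (g \<otimes> h, t)) \<in> measurable ?C ?C"
      using left_mult by measurable
    then show "cylinder_action G g \<in> measurable ?C ?C"
      by (subst measurable_cong[OF action_eq])
    have "distr ?C ?C (cylinder_action G g) = distr ?C ?C (\<lambda>(h, t). (g \<otimes> h, t))"
      using action_eq by (rule distr_cong[OF refl refl])
    also have "\<dots> = distr (haar G) (haar G) (\<lambda>h. g \<otimes> h) \<Otimes>\<^sub>M distr unit_lborel unit_lborel (\<lambda>t. t)"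
      using left_mult unit.sigma_finite_measure_axioms by (intro pair_measure_distr[symmetric]) simp_all
    also have "\<dots> = ?C"
      by (simp add: distr_uniform_count_measure_bij[OF fin bij_betw_mult_left[OF g]])
    finally show "distr ?C ?C (cylinder_action G g) = ?C" .
  qed
  then show ?thesis
    using group_action_cylinder_action fin prob_space_axioms
    by (intro finite_pmp_action.intro finite_pmp_action_axioms.intro) (simp_all add: cylinder)
qed

definition translate_pattern :: "('g, 'm) monoid_scheme \<Rightarrow> 'g \<Rightarrow> ('g \<Rightarrow> nat) \<Rightarrow> 'g \<Rightarrow> nat" where
  "translate_pattern G h p = (\<lambda>k\<in>carrier G. p (k \<otimes>\<^bsub>G\<^esub> h))"

lemma (in group) measurable_pair_translate_pattern:
  assumes "finite (carrier G)"
  shows "(\<lambda>(h, p). translate_pattern G h p) \<in> measurable (haar G \<Otimes>\<^sub>M pattern_space G r) (pattern_space G r)"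
  unfolding translate_pattern_def
  by (rule measurable_haar_pairI[OF assms]) (auto intro!: measurable_restrict measurable_component_singleton)

lemma (in group) distr_haar_pair_translate_pattern:
  assumes fin: "finite (carrier G)" and "prob_space \<Omega>" and q: "q \<in> measurable \<Omega> (pattern_space G r)"
  shows "distr (haar G \<Otimes>\<^sub>M \<Omega>) (pattern_space G r) (\<lambda>(h, \<omega>). translate_pattern G h (q \<omega>)) =
    distr (haar G \<Otimes>\<^sub>M distr \<Omega> (pattern_space G r) q) (pattern_space G r) (\<lambda>(h, p). translate_pattern G h p)"
proof -
  let ?\<Pi> = "pattern_space G r"
  interpret law: prob_space "distr \<Omega> ?\<Pi> q"
    using assms(2) q by (rule prob_space.prob_space_distr)
  have hq: "(\<lambda>(h, \<omega>). (h, q \<omega>)) \<in> measurable (haar G \<Otimes>\<^sub>M \<Omega>) (haar G \<Otimes>\<^sub>M ?\<Pi>)"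
    using q by measurable
  have "haar G \<Otimes>\<^sub>M distr \<Omega> ?\<Pi> q = distr (haar G \<Otimes>\<^sub>M \<Omega>) (haar G \<Otimes>\<^sub>M ?\<Pi>) (\<lambda>(h, \<omega>). (h, q \<omega>))"
    using pair_measure_distr[of "\<lambda>h. h" "haar G" "haar G", OF _ q law.sigma_finite_measure_axioms] by simp
  then have "distr (haar G \<Otimes>\<^sub>M distr \<Omega> ?\<Pi> q) ?\<Pi> (\<lambda>(h, p). translate_pattern G h p) =
      distr (haar G \<Otimes>\<^sub>M \<Omega>) ?\<Pi> ((\<lambda>(h, p). translate_pattern G h p) \<circ> (\<lambda>(h, \<omega>). (h, q \<omega>)))"
    using distr_distr[OF measurable_pair_translate_pattern[OF fin] hq] by simp
  then show ?thesis by (simp add: comp_def case_prod_unfold)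
qed

context finite_pmp_action
begin

lemma pattern_action:
  "h \<in> carrier G \<Longrightarrow> x \<in> space M \<Longrightarrow> pattern G \<phi> f (\<phi> h x) = translate_pattern G h (pattern G \<phi> f x)"
  by (auto simp: pattern_def translate_pattern_def composition_rule)

lemma prob_space_pattern_law:
  "f \<in> measurable M (count_space {..<r}) \<Longrightarrow> prob_space (pattern_law G \<phi> M r f)"
  unfolding pattern_law_def by (intro prob_space_distr measurable_pattern)

lemma distr_translate_pattern_law:
  assumes f: "f \<in> measurable M (count_space {..<r})"
  shows "distr (haar G \<Otimes>\<^sub>M pattern_law G \<phi> M r f) (pattern_space G r) (\<lambda>(h, p). translate_pattern G h p) =
    pattern_law G \<phi> M r f"
proof -
  let ?P = "haar G \<Otimes>\<^sub>M M"
  have "distr (haar G \<Otimes>\<^sub>M pattern_law G \<phi> M r f) (pattern_space G r) (\<lambda>(h, p). translate_pattern G h p) =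
      distr ?P (pattern_space G r) (\<lambda>(h, x). translate_pattern G h (pattern G \<phi> f x))"
    unfolding pattern_law_def
    using distr_haar_pair_translate_pattern[OF finite_carrier prob_space_axioms measurable_pattern[OF f]] by (rule sym)
  also have "\<dots> = distr ?P (pattern_space G r) (pattern G \<phi> f \<circ> (\<lambda>(h, x). \<phi> h x))"
    by (intro distr_cong refl)
      (auto simp: space_pair_measure space_uniform_count_measure pattern_action)
  also have "\<dots> = pattern_law G \<phi> M r f"
    using distr_distr[OF measurable_pattern[OF f] measurable_pair_action]
    by (simp add: distr_pair_action pattern_law_def)
  finally show ?thesis .
qed

lemma pattern_laws_subset_cylinder:
  "pattern_laws G \<phi> M r \<subseteq> pattern_laws G (cylinder_action G) (cylinder_measure G) r"
proof
  let ?\<Pi> = "pattern_space G r"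
  fix N assume "N \<in> pattern_laws G \<phi> M r"
  then obtain f where f: "f \<in> measurable M (count_space {..<r})" and N: "N = pattern_law G \<phi> M r f"
    unfolding pattern_laws_def by blast
  have "sets N = Pow (carrier G \<rightarrow>\<^sub>E {..<r})"
    using finite_carrier by (simp add: N pattern_law_def pattern_space_eq_count_space)
  moreover have "countable (carrier G \<rightarrow>\<^sub>E {..<r})"
    using finite_carrier by (intro countable_finite finite_PiE) auto
  ultimately obtain q where "q \<in> measurable unit_lborel N" "distr unit_lborel N q = N"
    using ex_distr_unit_lborel_countable[OF prob_space_pattern_law[OF f]] N by metis
  then have q: "q \<in> measurable unit_lborel ?\<Pi>" "distr unit_lborel ?\<Pi> q = N"
    by (simp_all add: N pattern_law_def cong: measurable_cong_sets distr_cong)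
  define f' where "f' = (\<lambda>(h, t). q t h)"
  have f': "f' \<in> measurable (cylinder_measure G) (count_space {..<r})"
    unfolding cylinder_measure_def f'_def
    using measurable_compose[OF q(1) measurable_component_singleton]
    by (intro measurable_haar_pairI[OF finite_carrier]) simp
  have "pattern_law G (cylinder_action G) (cylinder_measure G) r f' =
      distr (haar G \<Otimes>\<^sub>M unit_lborel) ?\<Pi> (\<lambda>(h, t). translate_pattern G h (q t))"
    unfolding pattern_law_def cylinder_measure_def[symmetric]
    by (intro distr_cong refl)
      (auto simp: space_cylinder_measure pattern_def translate_pattern_def f'_def cylinder_action_apply)
  also have "\<dots> = distr (haar G \<Otimes>\<^sub>M N) ?\<Pi> (\<lambda>(h, p). translate_pattern G h p)"
    using distr_haar_pair_translate_pattern[OF finite_carrier prob_space_unit_lborel q(1)] by (simp only: q(2))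
  also have "\<dots> = N"
    unfolding N using f by (rule distr_translate_pattern_law)
  finally show "N \<in> pattern_laws G (cylinder_action G) (cylinder_measure G) r"
    using f' by (auto simp: pattern_laws_def)
qed

theorem ms_cylinder_le_ms: "ms G (cylinder_action G) (cylinder_measure G) r \<le> ms G \<phi> M r"
  using finite_pmp_action_cylinder[OF finite_carrier] finite_pmp_action_axioms pattern_laws_subset_cylinder
  by (rule ms_antimono_pattern_laws)

end

section \<open>Free actions as extensions of the cylinder\<close>

lemma measurable_SOME_finite:
  assumes "finite I" "\<And>i. i \<in> I \<Longrightarrow> Measurable.pred M (P i)"
    and ex: "\<And>x. x \<in> space M \<Longrightarrow> \<exists>i\<in>I. P i x"
  shows "(\<lambda>x. SOME i. i \<in> I \<and> P i x) \<in> measurable M (count_space I)"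
proof -
  let ?choose = "\<lambda>p. SOME i. i \<in> I \<and> p i"
  have "(\<lambda>x. \<lambda>i\<in>I. P i x) \<in> measurable M (PiM I (\<lambda>_. count_space UNIV))"
    using assms(2) by (intro measurable_restrict) (simp add: pred_def)
  then have "(\<lambda>x. \<lambda>i\<in>I. P i x) \<in> measurable M (count_space (I \<rightarrow>\<^sub>E UNIV))"
    using count_space_PiM_finite[OF assms(1), of "\<lambda>_. UNIV :: bool set"] by simp
  then have "(\<lambda>x. ?choose (\<lambda>i\<in>I. P i x)) \<in> measurable M (count_space UNIV)"
    by (rule measurable_compose) simp
  also have "(\<lambda>x. ?choose (\<lambda>i\<in>I. P i x)) = (\<lambda>x. ?choose (\<lambda>i. P i x))"
    by (simp cong: conj_cong)
  finally have "(\<lambda>x. ?choose (\<lambda>i. P i x)) \<in> measurable M (count_space UNIV)" .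
  moreover have "?choose (\<lambda>i. P i x) \<in> I" if "x \<in> space M" for x
    using ex[OF that] by (metis (mono_tags, lifting) someI)
  ultimately show ?thesis
    by (auto simp: measurable_def)
qed

context finite_pmp_action
begin

definition orbit_min :: "('x \<Rightarrow> real) \<Rightarrow> 'x \<Rightarrow> real" where
  "orbit_min \<tau> x = Min ((\<lambda>g. \<tau> (\<phi> g x)) ` carrier G)"

definition orbit_coordinate :: "('x \<Rightarrow> real) \<Rightarrow> 'x \<Rightarrow> 'g" where
  "orbit_coordinate \<tau> x = (SOME g. g \<in> carrier G \<and> \<tau> (\<phi> (inv g) x) = orbit_min \<tau> x)"

lemma orbit_min_attained: "\<exists>g\<in>carrier G. orbit_min \<tau> x = \<tau> (\<phi> g x)"
proof -
  have "orbit_min \<tau> x \<in> (\<lambda>g. \<tau> (\<phi> g x)) ` carrier G"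
    unfolding orbit_min_def using finite_carrier one_closed by (intro Min_in) auto
  then show ?thesis by blast
qed

lemma ex_orbit_coordinate: "\<exists>g\<in>carrier G. \<tau> (\<phi> (inv g) x) = orbit_min \<tau> x"
  using orbit_min_attained by (metis inv_closed inv_inv)

lemma orbit_min_action:
  assumes "g \<in> carrier G" "x \<in> space M"
  shows "orbit_min \<tau> (\<phi> g x) = orbit_min \<tau> x"
proof -
  have "(\<lambda>h. \<tau> (\<phi> h (\<phi> g x))) ` carrier G = (\<lambda>h. \<tau> (\<phi> h x)) ` (\<lambda>h. h \<otimes> g) ` carrier G"
    using assms by (auto simp: image_image composition_rule intro!: image_cong)
  also have "(\<lambda>h. h \<otimes> g) ` carrier G = carrier G"
    using bij_betw_mult_right[OF assms(1)] by (rule bij_betw_imp_surj_on)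
  finally show ?thesis by (simp add: orbit_min_def)
qed

lemma borel_measurable_orbit_min:
  assumes "\<tau> \<in> borel_measurable M"
  shows "orbit_min \<tau> \<in> borel_measurable M"
  unfolding orbit_min_def using finite_carrier measurable_compose[OF measurable_action assms]
  by (intro borel_measurable_Min)

lemma measurable_orbit_coordinate:
  assumes \<tau>: "\<tau> \<in> borel_measurable M"
  shows "orbit_coordinate \<tau> \<in> measurable M (haar G)"
proof -
  note [measurable] = borel_measurable_orbit_min[OF \<tau>]
  have "Measurable.pred M (\<lambda>x. \<tau> (\<phi> (inv g) x) = orbit_min \<tau> x)" if "g \<in> carrier G" for g
  proof -
    have [measurable]: "(\<lambda>x. \<tau> (\<phi> (inv g) x)) \<in> borel_measurable M"
      using measurable_compose[OF measurable_action \<tau>] that by simp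
    show ?thesis by measurable
  qed
  then have "orbit_coordinate \<tau> \<in> measurable M (count_space (carrier G))"
    unfolding orbit_coordinate_def using ex_orbit_coordinate
    by (intro measurable_SOME_finite[OF finite_carrier])
  then show ?thesis
    by (simp add: measurable_cong_sets[OF refl sets_uniform_count_measure_count_space])
qed

lemma orbit_coordinate_eqI:
  assumes inj: "inj_on (\<lambda>g. \<tau> (\<phi> g x)) (carrier G)"
    and g: "g \<in> carrier G" "\<tau> (\<phi> (inv g) x) = orbit_min \<tau> x"
  shows "orbit_coordinate \<tau> x = g"
  unfolding orbit_coordinate_def
proof (rule some_equality)
  fix h assume "h \<in> carrier G \<and> \<tau> (\<phi> (inv h) x) = orbit_min \<tau> x"
  then show "h = g"
    using inj_onD[OF inj, of "inv h" "inv g"] g by (metis inv_closed inv_inv)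
qed (use g in simp)

lemma orbit_coordinate_action:
  assumes inj: "inj_on (\<lambda>g. \<tau> (\<phi> g x)) (carrier G)" and a: "a \<in> carrier G" and x: "x \<in> space M"
  shows "orbit_coordinate \<tau> (\<phi> a x) = a \<otimes> orbit_coordinate \<tau> x"
proof -
  obtain g where g: "g \<in> carrier G" "\<tau> (\<phi> (inv g) x) = orbit_min \<tau> x"
    using ex_orbit_coordinate by blast
  show ?thesis
    unfolding orbit_coordinate_eqI[OF inj g]
  proof (rule orbit_coordinate_eqI)
    have "inj_on (\<lambda>h. \<tau> (\<phi> (h \<otimes> a) x)) (carrier G)"
      using comp_inj_on[of "\<lambda>h. h \<otimes> a" "carrier G" "\<lambda>h. \<tau> (\<phi> h x)"] inj bij_betw_mult_right[OF a]
      by (simp add: bij_betw_def comp_def)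
    then show "inj_on (\<lambda>h. \<tau> (\<phi> h (\<phi> a x))) (carrier G)"
      using a x by (simp add: composition_rule cong: inj_on_cong)
    have "\<phi> (inv (a \<otimes> g)) (\<phi> a x) = \<phi> (inv g) x"
      using a g x action_closed composition_rule[of "\<phi> a x" "inv g" "inv a"]
      by (simp add: inv_mult_group action_inv)
    then show "\<tau> (\<phi> (inv (a \<otimes> g)) (\<phi> a x)) = orbit_min \<tau> (\<phi> a x)"
      using g(2) orbit_min_action[OF a x] by simp
  qed (use a g in simp)
qed

lemma distr_orbit_min_atomless:
  assumes \<tau>: "\<tau> \<in> borel_measurable M" and atomless: "\<And>y. AE x in M. \<tau> x \<noteq> y"
  shows "measure (distr M borel (orbit_min \<tau>)) {y} = 0"
proof -
  have "AE x in M. orbit_min \<tau> x \<noteq> y"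
    using AE_action[OF atomless[of y]]
  proof eventually_elim
    case (elim x)
    then show ?case using orbit_min_attained[of \<tau> x] by auto
  qed
  then have "prob {x \<in> space M. orbit_min \<tau> x = y} = 0"
    using prob_eq_0 borel_measurable_orbit_min[OF \<tau>] by simp
  moreover have "orbit_min \<tau> -` {y} \<inter> space M = {x \<in> space M. orbit_min \<tau> x = y}" by auto
  ultimately show ?thesis
    using borel_measurable_orbit_min[OF \<tau>] by (simp add: measure_distr)
qed

lemma ex_invariant_uniform:
  fixes \<tau> :: "'x \<Rightarrow> real"
  assumes \<tau>: "\<tau> \<in> borel_measurable M" and atomless: "\<And>y. AE x in M. \<tau> x \<noteq> y"
  obtains height where "height \<in> measurable M unit_lborel" "distr M unit_lborel height = unit_lborel"
    "\<And>g x. g \<in> carrier G \<Longrightarrow> x \<in> space M \<Longrightarrow> height (\<phi> g x) = height x"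
proof -
  let ?law = "distr M borel (orbit_min \<tau>)"
  note orbit_min = borel_measurable_orbit_min[OF \<tau>]
  interpret law: cdf_distribution ?law
    by (intro cdf_distribution.intro real_distribution_distr orbit_min)
  note cdf = law.measurable_cdf_unit_lborel
  show ?thesis
  proof (rule that)
    show "cdf ?law \<circ> orbit_min \<tau> \<in> measurable M unit_lborel"
      using orbit_min cdf by (rule measurable_comp)
    show "distr M unit_lborel (cdf ?law \<circ> orbit_min \<tau>) = unit_lborel"
      using distr_distr[OF cdf orbit_min] law.distr_cdf[OF distr_orbit_min_atomless[OF \<tau> atomless]]
      by simp
  qed (simp add: orbit_min_action)
qed

lemma ex_cylinder_factor:
  fixes \<tau> :: "'x \<Rightarrow> real"
  assumes \<tau>: "\<tau> \<in> borel_measurable M" and atomless: "\<And>y. AE x in M. \<tau> x \<noteq> y"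
    and inj: "AE x in M. inj_on (\<lambda>g. \<tau> (\<phi> g x)) (carrier G)"
  obtains T where "T \<in> measurable M (cylinder_measure G)"
    "distr M (cylinder_measure G) T = cylinder_measure G"
    "AE x in M. \<forall>g\<in>carrier G. T (\<phi> g x) = cylinder_action G g (T x)"
proof -
  note coordinate = measurable_orbit_coordinate[OF \<tau>]
  obtain height where height: "height \<in> measurable M unit_lborel" "distr M unit_lborel height = unit_lborel"
    and height_action: "\<And>g x. g \<in> carrier G \<Longrightarrow> x \<in> space M \<Longrightarrow> height (\<phi> g x) = height x"
    using ex_invariant_uniform[OF \<tau> atomless] by blast
  have equivariant: "AE x in M. \<forall>g\<in>carrier G. orbit_coordinate \<tau> (\<phi> g x) = g \<otimes> orbit_coordinate \<tau> x"
    using inj AE_space by eventually_elim (simp add: orbit_coordinate_action)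
  have invariant: "AE x in M. \<forall>g\<in>carrier G. height (\<phi> g x) = height x"
    using AE_space by eventually_elim (simp add: height_action)
  define T where "T x = (orbit_coordinate \<tau> x, height x)" for x
  show ?thesis
  proof (rule that)
    show T: "T \<in> measurable M (cylinder_measure G)"
      unfolding T_def cylinder_measure_def using coordinate height(1) by measurable
    show "distr M (cylinder_measure G) T = cylinder_measure G"
      unfolding T_def cylinder_measure_def
      using distr_equivariant_invariant[OF coordinate height(1) equivariant invariant]
      by (simp only: height(2))
    show "AE x in M. \<forall>g\<in>carrier G. T (\<phi> g x) = cylinder_action G g (T x)"
      using equivariant invariant AE_space
    proof eventually_elim
      case (elim x)
      then have "orbit_coordinate \<tau> x \<in> carrier G" "height x \<in> {0..1}"
        using measurable_space[OF T, of x] by (simp_all add: T_def space_cylinder_measure)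
      then show ?case using elim by (simp add: T_def cylinder_action_apply)
    qed
  qed
qed

end

lemma card_orbit_eq_order_imp_inj_on:
  assumes "finite (carrier G)" "card (orbit G \<phi> x) = order G"
  shows "inj_on (\<lambda>g. \<phi> g x) (carrier G)"
proof -
  have "orbit G \<phi> x = (\<lambda>g. \<phi> g x) ` carrier G" by (auto simp: orbit_def)
  then show ?thesis
    using assms by (intro eq_card_imp_inj_on) (simp_all add: order_def)
qed

lemma continuous_measure_imp_AE_neq:
  fixes \<tau> :: "'x \<Rightarrow> real"
  assumes "continuous_measure M" "\<tau> \<in> borel_measurable M" "inj_on \<tau> (space M)"
  shows "AE x in M. \<tau> x \<noteq> y"
proof (cases "\<exists>x\<in>space M. \<tau> x = y")
  case True
  then obtain a where a: "a \<in> space M" "\<tau> a = y" by blast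
  then have "{x \<in> space M. \<tau> x = y} = {a}"
    using assms(3) by (auto simp: inj_on_def)
  moreover have "{x \<in> space M. \<tau> x = y} \<in> sets M" using assms(2) by measurable
  moreover have "emeasure M {a} = 0"
    using assms(1) a(1) by (simp add: continuous_measure_def)
  ultimately show ?thesis by (intro AE_I[of _ _ "{a}"]) auto
qed (use AE_space in \<open>auto elim!: eventually_mono\<close>)

theorem (in finite_pmp_action) ms_le_ms_cylinder:
  fixes \<tau> :: "'x \<Rightarrow> real"
  assumes \<tau>: "\<tau> \<in> borel_measurable M" "inj_on \<tau> (space M)" and "continuous_measure M"
    and free: "AE x in M. card (orbit G \<phi> x) = order G"
  shows "ms G \<phi> M r \<le> ms G (cylinder_action G) (cylinder_measure G) r"
proof -
  note cylinder = finite_pmp_action_cylinder[OF finite_carrier]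
  have "AE x in M. inj_on (\<lambda>g. \<tau> (\<phi> g x)) (carrier G)"
    using free AE_space
  proof eventually_elim
    case (elim x)
    have "(\<lambda>g. \<phi> g x) ` carrier G \<subseteq> space M" using elim(2) action_closed by auto
    then have "inj_on (\<tau> \<circ> (\<lambda>g. \<phi> g x)) (carrier G)"
      using card_orbit_eq_order_imp_inj_on[OF finite_carrier elim(1)] \<tau>(2) by (intro comp_inj_on) (auto intro: inj_on_subset)
    then show ?case by (simp add: comp_def)
  qed
  then obtain T where "T \<in> measurable M (cylinder_measure G)"
    "distr M (cylinder_measure G) T = cylinder_measure G"
    "AE x in M. \<forall>g\<in>carrier G. T (\<phi> g x) = cylinder_action G g (T x)"
    using ex_cylinder_factor[OF \<tau>(1) continuous_measure_imp_AE_neq[OF assms(3) \<tau>]] by blast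
  then have "pattern_laws G (cylinder_action G) (cylinder_measure G) r \<subseteq> pattern_laws G \<phi> M r"
    by (rule pattern_laws_factor_subset[OF finite_pmp_action_axioms cylinder])
  then show ?thesis
    by (rule ms_antimono_pattern_laws[OF finite_pmp_action_axioms cylinder])
qed

section \<open>Continuous actions\<close>

lemma continuous_group_action_imp_finite_pmp_action:
  assumes "finite (carrier G)" "continuous_group_action G X \<phi>"
    and "prob_space \<mu>" "sets \<mu> = sets (borel_of X)" "invariant_measure G \<phi> \<mu>"
  shows "finite_pmp_action G \<mu> \<phi>"
proof -
  have space: "space \<mu> = topspace X"
    using sets_eq_imp_space_eq[OF assms(4)] by (simp add: space_borel_of)
  interpret group_action G "space \<mu>" \<phi>
    using assms(2) by (simp add: continuous_group_action_def space)
  have measurable: "\<phi> g \<in> measurable \<mu> \<mu>" if "g \<in> carrier G" for g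
    using measurable_borel_of[of X X "\<phi> g"] assms(2,4) that
    by (simp add: continuous_group_action_def cong: measurable_cong_sets)
  moreover have "distr \<mu> \<mu> (\<phi> g) = \<mu>" if g: "g \<in> carrier G" for g
  proof (rule measure_eqI)
    fix A assume "A \<in> sets (distr \<mu> \<mu> (\<phi> g))"
    then have A: "A \<in> sets \<mu>" by simp
    then have "A \<subseteq> \<phi> g ` space \<mu>"
      using sets.sets_into_space surj_prop[OF g] by simp
    then have image_vimage: "\<phi> g ` (\<phi> g -` A \<inter> space \<mu>) = A" by auto
    have "emeasure (distr \<mu> \<mu> (\<phi> g)) A = emeasure \<mu> (\<phi> g -` A \<inter> space \<mu>)"
      using measurable[OF g] A by (rule emeasure_distr)
    also have "\<dots> = emeasure \<mu> (\<phi> g ` (\<phi> g -` A \<inter> space \<mu>))"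
      using assms(5) g measurable_sets[OF measurable[OF g] A] by (simp add: invariant_measure_def)
    also have "\<dots> = emeasure \<mu> A"
      by (simp only: image_vimage)
    finally show "emeasure (distr \<mu> \<mu> (\<phi> g)) A = emeasure \<mu> A" .
  qed simp
  ultimately show ?thesis
    using assms(1,3) group_action_axioms by (intro finite_pmp_action.intro finite_pmp_action_axioms.intro)
qed

theorem theorem7p1:
  fixes G :: "('g, 'm) monoid_scheme"
    and X :: "'x topology"
    and \<phi> :: "'g \<Rightarrow> 'x \<Rightarrow> 'x"
    and \<mu> :: "'x measure"
    and r :: nat
  assumes "group G" and "finite (carrier G)"
    and "compact_space X" and "metrizable_space X"
    and "continuous_group_action G X \<phi>"
    and "prob_space \<mu>" and "sets \<mu> = sets (borel_of X)"
    and "invariant_measure G \<phi> \<mu>"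
  shows "ms G \<phi> \<mu> r \<ge> ms G (cylinder_action G) (cylinder_measure G) r \<and>
    (continuous_measure \<mu> \<and> (AE x in \<mu>. card (orbit G \<phi> x) = order G) \<longrightarrow>
       ms G \<phi> \<mu> r = ms G (cylinder_action G) (cylinder_measure G) r)"
proof -
  interpret finite_pmp_action G \<mu> \<phi>
    using assms by (intro continuous_group_action_imp_finite_pmp_action)
  have "second_countable X"
    using assms(3,4) by (rule compact_metrizable_imp_second_countable)
  moreover have "t0_space X"
    using assms(4) by (intro t1_imp_t0_space Hausdorff_imp_t1_space metrizable_imp_Hausdorff_space)
  ultimately obtain \<tau> :: "'x \<Rightarrow> real"
    where "\<tau> \<in> borel_measurable (borel_of X)" "inj_on \<tau> (topspace X)"
    by (rule ex_injective_borel_measurable_of)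
  then have "\<tau> \<in> borel_measurable \<mu>" "inj_on \<tau> (space \<mu>)"
    using assms(7) sets_eq_imp_space_eq[OF assms(7)]
    by (simp_all add: space_borel_of cong: measurable_cong_sets)
  then show ?thesis
    using ms_cylinder_le_ms ms_le_ms_cylinder by (blast intro: antisym)
qed

end
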